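(* Let $n\ge 0$, let $\phi=\{\phi_k\}_{k=0}^n$ be a basis of the space of univariate (real or complex) polynomials of degree at most $n$, and let $\mathbf{D}_\phi$ be the differentiation matrix in this basis. Let $\mathbf{V}$ be the $(n+1)\times(n+1)$ matrix whose $k$-th column (numbered from $0$ to $n$) is $\frac{1}{k!}\mathbf{X}_\phi^k$, where $\mathbf{X}_\phi^k$ is the coefficient vector of $x^k$ in the basis $\phi$. Then $$\mathbf{D}_\phi\mathbf{V}=\mathbf{V}\mathbf{J},$$ where $\mathbf{J}$ is the $(n+1)\times(n+1)$ matrix with ones on the first superdiagonal and zeros elsewhere, and $\mathbf{J}$ is the Jordan canonical form of $\mathbf{D}_\phi$.
   Context: The differentiation matrix $\mathbf{D}_\phi$ is the $(n+1)\times(n+1)$ matrix such that if $f=\sum_{k=0}^n a_k\phi_k$ and $f'=\sum_{k=0}^n b_k\phi_k$ then $\mathbf{b}=\mathbf{D}_\phi\mathbf{a}$, where $\mathbf{a}=[a_0,\ldots,a_n]^T$ and $\mathbf{b}=[b_0,\ldots,b_n]^T$. The basis is not assumed to be degree-graded. If $x^k=b_{k,0}\phi_0(x)+b_{k,1}\phi_1(x)+\cdots+b_{k,n}\phi_n(x)$, then $\mathbf{X}_\phi^k=[b_{k,0},b_{k,1},\ldots,b_{k,n}]^T$. *)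

theory Defs
  imports "Jordan_Normal_Form.Jordan_Normal_Form"
begin

text \<open>Injectivity is needed because linear independence is a property of the \<^emph>\<open>set\<close> of
  the \<open>\<phi> k\<close>, which would not detect a repeated entry of the family.\<close>

definition poly_basis :: "nat \<Rightarrow> (nat \<Rightarrow> 'a :: field poly) \<Rightarrow> bool" where
  "poly_basis n \<phi> \<longleftrightarrow>
     inj_on \<phi> {..n} \<and>
     \<not> Modules.module.dependent Polynomial.smult (\<phi> ` {..n}) \<and>
     Modules.module.span Polynomial.smult (\<phi> ` {..n}) = {p. degree p \<le> n}"

definition lin_comb :: "nat \<Rightarrow> (nat \<Rightarrow> 'a :: field poly) \<Rightarrow> 'a vec \<Rightarrow> 'a poly" where
  "lin_comb n \<phi> a = (\<Sum>k\<le>n. Polynomial.smult (a $ k) (\<phi> k))"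

text \<open>The two descriptions below are proper when \<open>poly_basis n \<phi>\<close> holds (and, for the
  first, \<open>degree p \<le> n\<close>).\<close>

definition coeff_vec :: "nat \<Rightarrow> (nat \<Rightarrow> 'a :: field poly) \<Rightarrow> 'a poly \<Rightarrow> 'a vec" where
  "coeff_vec n \<phi> p = (THE a. a \<in> carrier_vec (n + 1) \<and> p = lin_comb n \<phi> a)"

definition diff_matrix :: "nat \<Rightarrow> (nat \<Rightarrow> 'a :: field poly) \<Rightarrow> 'a mat" where
  "diff_matrix n \<phi> = (THE D. D \<in> carrier_mat (n + 1) (n + 1) \<and>
     (\<forall>a \<in> carrier_vec (n + 1). \<forall>b \<in> carrier_vec (n + 1).
        pderiv (lin_comb n \<phi> a) = lin_comb n \<phi> b \<longrightarrow> b = D *\<^sub>v a))"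

definition X_vec :: "nat \<Rightarrow> (nat \<Rightarrow> 'a :: field poly) \<Rightarrow> nat \<Rightarrow> 'a vec" where
  "X_vec n \<phi> k = coeff_vec n \<phi> (monom 1 k)"

definition V_matrix :: "nat \<Rightarrow> (nat \<Rightarrow> 'a :: field_char_0 poly) \<Rightarrow> 'a mat" where
  "V_matrix n \<phi> =
     mat_of_cols (n + 1) (map (\<lambda>k. (1 / fact k) \<cdot>\<^sub>v X_vec n \<phi> k) [0..<n + 1])"

definition J_matrix :: "nat \<Rightarrow> 'a :: zero_neq_one mat" where
  "J_matrix n = mat (n + 1) (n + 1) (\<lambda>(i, j). if j = i + 1 then 1 else 0)"

definition is_jordan_canonical_form :: "'a :: field mat \<Rightarrow> 'a mat \<Rightarrow> bool" where
  "is_jordan_canonical_form A J \<longleftrightarrow> (\<exists>n_as. jordan_nf A n_as \<and> J = jordan_matrix n_as)"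

end

theory Submission
  imports Defs "Jordan_Normal_Form.Jordan_Normal_Form_Uniqueness"
begin

text \<open>Taylor coefficients at 0, \<open>p \<mapsto> (i! [x\<^sup>i] p)\<^sub>i\<close>, turn differentiation into the shift \<open>J\<close>.
  Written in the basis \<open>\<phi>\<close>, this map is a matrix \<open>C\<close>, and its inverse is \<open>V\<close>, since the
  polynomials \<open>x\<^sup>k / k!\<close> are sent to the unit vectors. Hence the differentiation matrix is
  \<open>V J C = V J V\<^sup>-\<^sup>1\<close>, and \<open>J\<close> is a single Jordan block.\<close>

section \<open>Taylor coordinates at 0\<close>

definition taylor_matrix :: "nat \<Rightarrow> (nat \<Rightarrow> 'a :: field_char_0 poly) \<Rightarrow> 'a mat" where
  "taylor_matrix n \<phi> = mat (n + 1) (n + 1) (\<lambda>(i, j). fact i * coeff (\<phi> j) i)"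

lemma taylor_matrix_carrier [simp]:
  "taylor_matrix n \<phi> \<in> carrier_mat (n + 1) (n + 1)"
  by (simp add: taylor_matrix_def)

lemma J_matrix_carrier [simp]: "J_matrix n \<in> carrier_mat (n + 1) (n + 1)"
  by (simp add: J_matrix_def)

lemma mat_of_cols_map_upt_carrier: "mat_of_cols m (map w [0..<k]) \<in> carrier_mat m k"
  using mat_of_cols_carrier(1)[of m "map w [0..<k]"] by simp

lemma V_matrix_carrier [simp]: "V_matrix n \<phi> \<in> carrier_mat (n + 1) (n + 1)"
  unfolding V_matrix_def by (rule mat_of_cols_map_upt_carrier)

text \<open>Extracting a coefficient is linear, so \<open>taylor_matrix\<close> acts on coordinates
  as the Taylor map acts on polynomials: entry \<open>i\<close> is the \<open>i\<close>-th
  derivative at 0.\<close>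

lemma taylor_matrix_mult_vec:
  fixes \<phi> :: "nat \<Rightarrow> 'a :: field_char_0 poly"
  assumes "a \<in> carrier_vec (n + 1)"
  shows "taylor_matrix n \<phi> *\<^sub>v a = vec (n + 1) (\<lambda>i. fact i * coeff (lin_comb n \<phi> a) i)"
proof (rule eq_vecI)
  fix i assume "i < dim_vec (vec (n + 1) (\<lambda>i. fact i * coeff (lin_comb n \<phi> a) i))"
  then have i: "i < n + 1" by simp
  have "(taylor_matrix n \<phi> *\<^sub>v a) $ i = (\<Sum>k\<in>{0..<n + 1}. fact i * coeff (\<phi> k) i * a $ k)"
    using i assms by (simp add: taylor_matrix_def scalar_prod_def del: sum.op_ivl_Suc)
  also have "{0..<n + 1} = {..n}" by auto
  also have "(\<Sum>k\<in>{..n}. fact i * coeff (\<phi> k) i * a $ k)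
      = (\<Sum>k\<in>{..n}. fact i * (a $ k * coeff (\<phi> k) i))"
    by (rule sum.cong) (simp_all add: mult_ac)
  also have "\<dots> = fact i * coeff (lin_comb n \<phi> a) i"
    by (simp add: lin_comb_def coeff_sum sum_distrib_left)
  finally show "(taylor_matrix n \<phi> *\<^sub>v a) $ i
      = vec (n + 1) (\<lambda>i. fact i * coeff (lin_comb n \<phi> a) i) $ i"
    using i by simp
qed (simp add: taylor_matrix_def)

section \<open>Existence and uniqueness of coordinates, and the inverse of the Taylor matrix\<close>

lemma lin_comb_smult:
  assumes a: "a \<in> carrier_vec (n + 1)"
  shows "lin_comb n \<phi> (c \<cdot>\<^sub>v a) = Polynomial.smult c (lin_comb n \<phi> a)"
proof -
  have "lin_comb n \<phi> (c \<cdot>\<^sub>v a) = (\<Sum>k\<le>n. Polynomial.smult c (Polynomial.smult (a $ k) (\<phi> k)))"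
    unfolding lin_comb_def by (rule sum.cong) (use a in simp_all)
  then show ?thesis by (simp only: lin_comb_def smult_sum2)
qed

text \<open>Passes from the span of the set of basis elements to sums over the indexed family;
  injectivity of \<open>\<phi>\<close> permits the reindexing.\<close>

lemma poly_basis_lin_comb:
  fixes \<phi> :: "nat \<Rightarrow> 'a :: field poly"
  assumes "poly_basis n \<phi>"
  shows degree_lin_comb_le: "degree (lin_comb n \<phi> a) \<le> n"
    and exists_lin_comb: "degree p \<le> n \<Longrightarrow> \<exists>a \<in> carrier_vec (n + 1). lin_comb n \<phi> a = p"
proof -
  interpret poly: Modules.module "Polynomial.smult :: 'a \<Rightarrow> 'a poly \<Rightarrow> 'a poly"
    by unfold_locales (simp_all add: smult_add_right smult_add_left)
  have inj: "inj_on \<phi> {..n}" and span: "poly.span (\<phi> ` {..n}) = {p. degree p \<le> n}"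
    using assms by (simp_all add: poly_basis_def)
  have "lin_comb n \<phi> a \<in> poly.span (\<phi> ` {..n})"
    unfolding lin_comb_def
    by (intro poly.span_sum poly.span_scale poly.span_base) auto
  then show "degree (lin_comb n \<phi> a) \<le> n" using span by simp
  assume "degree p \<le> n"
  then have "p \<in> poly.span (\<phi> ` {..n})" using span by simp
  then obtain u where "p = (\<Sum>v\<in>\<phi> ` {..n}. Polynomial.smult (u v) v)"
    by (subst (asm) poly.span_finite) auto
  then have "p = (\<Sum>k\<le>n. Polynomial.smult (u (\<phi> k)) (\<phi> k))"
    by (simp add: sum.reindex[OF inj])
  also have "\<dots> = lin_comb n \<phi> (vec (n + 1) (\<lambda>k. u (\<phi> k)))"
    unfolding lin_comb_def by (rule sum.cong) auto
  finally show "\<exists>a \<in> carrier_vec (n + 1). lin_comb n \<phi> a = p"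
    by (metis vec_carrier)
qed

text \<open>The Taylor map sends x^k / k! to the \<open>k\<close>-th unit vector. The coordinate
  vectors \<open>w\<close> are left arbitrary so that this applies both before coordinates are known
  to be unique and, afterwards, to \<open>V_matrix\<close>.\<close>

lemma taylor_matrix_mult_mat_of_cols:
  fixes \<phi> :: "nat \<Rightarrow> 'a :: field_char_0 poly"
  assumes w: "\<And>k. k \<le> n \<Longrightarrow> w k \<in> carrier_vec (n + 1)"
    and lc: "\<And>k. k \<le> n \<Longrightarrow> lin_comb n \<phi> (w k) = monom (1 / fact k) k"
  shows "taylor_matrix n \<phi> * mat_of_cols (n + 1) (map w [0..<n + 1]) = 1\<^sub>m (n + 1)"
    (is "?C * ?W = _")
proof (rule mat_col_eqI)
  fix j assume "j < dim_col (1\<^sub>m (n + 1) :: 'a mat)"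
  then have j: "j < n + 1" by simp
  have W: "?W \<in> carrier_mat (n + 1) (n + 1)"
    by (rule mat_of_cols_map_upt_carrier)
  have "map w [0..<n + 1] ! j = w j"
    using j by (simp del: upt_Suc)
  then have "col ?W j = w j"
    using j w[of j] by (subst col_mat_of_cols) (simp_all del: upt_Suc)
  then have "col (?C * ?W) j = ?C *\<^sub>v w j"
    using col_mult2[OF taylor_matrix_carrier W j] by simp
  also have "\<dots> = unit_vec (n + 1) j"
    using j w[of j] lc[of j] by (intro eq_vecI) (auto simp: taylor_matrix_mult_vec unit_vec_def)
  also have "\<dots> = col (1\<^sub>m (n + 1)) j" using j by simp
  finally show "col (?C * ?W) j = col (1\<^sub>m (n + 1)) j" .
qed (simp_all add: taylor_matrix_def)

text \<open>A right inverse of a square matrix over a field is also a left inverse. Hence the Taylor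
  matrix is injective, and equal polynomials have equal Taylor coefficients.\<close>

lemma lin_comb_unique:
  fixes \<phi> :: "nat \<Rightarrow> 'a :: field_char_0 poly"
  assumes basis: "poly_basis n \<phi>"
    and a: "a \<in> carrier_vec (n + 1)" and b: "b \<in> carrier_vec (n + 1)"
    and eq: "lin_comb n \<phi> a = lin_comb n \<phi> b"
  shows "a = b"
proof -
  \<comment> \<open>Some representation of each x^k / k! is chosen here: the columns of
    \<open>V_matrix\<close> are definite descriptions, which become usable only once uniqueness is
    proved.\<close>
  have "\<forall>k. \<exists>v. k \<le> n \<longrightarrow> v \<in> carrier_vec (n + 1) \<and> lin_comb n \<phi> v = monom (1 / fact k) k"
    by (metis exists_lin_comb[OF basis] degree_monom_le le_trans)
  then obtain w where w: "\<And>k. k \<le> n \<Longrightarrow> w k \<in> carrier_vec (n + 1)"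
      "\<And>k. k \<le> n \<Longrightarrow> lin_comb n \<phi> (w k) = monom (1 / fact k) k"
    by metis
  let ?C = "taylor_matrix n \<phi>" and ?W = "mat_of_cols (n + 1) (map w [0..<n + 1])"
  have W: "?W \<in> carrier_mat (n + 1) (n + 1)"
    by (rule mat_of_cols_map_upt_carrier)
  have WC: "?W * ?C = 1\<^sub>m (n + 1)"
    by (rule mat_mult_left_right_inverse[OF taylor_matrix_carrier W
          taylor_matrix_mult_mat_of_cols[OF w]])
  have cancel: "?W *\<^sub>v (?C *\<^sub>v v) = v" if "v \<in> carrier_vec (n + 1)" for v
    unfolding assoc_mult_mat_vec[OF W taylor_matrix_carrier that, symmetric] WC
    by (rule one_mult_mat_vec[OF that])
  have "?C *\<^sub>v a = ?C *\<^sub>v b"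
    by (simp add: taylor_matrix_mult_vec[OF a] taylor_matrix_mult_vec[OF b] eq)
  then show "a = b" using cancel[OF a] cancel[OF b] by metis
qed

text \<open>Existence and uniqueness of coordinates make the description in \<open>coeff_vec\<close>
  proper.\<close>

lemma coeff_vec:
  fixes \<phi> :: "nat \<Rightarrow> 'a :: field_char_0 poly"
  assumes basis: "poly_basis n \<phi>" and deg: "degree p \<le> n"
  shows coeff_vec_carrier: "coeff_vec n \<phi> p \<in> carrier_vec (n + 1)"
    and lin_comb_coeff_vec: "lin_comb n \<phi> (coeff_vec n \<phi> p) = p"
proof -
  have "\<exists>!a. a \<in> carrier_vec (n + 1) \<and> p = lin_comb n \<phi> a"
    using exists_lin_comb[OF basis deg] lin_comb_unique[OF basis] by blast
  from theI'[OF this] show "coeff_vec n \<phi> p \<in> carrier_vec (n + 1)"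
    "lin_comb n \<phi> (coeff_vec n \<phi> p) = p"
    by (simp_all add: coeff_vec_def)
qed

lemma V_matrix_inverse:
  fixes \<phi> :: "nat \<Rightarrow> 'a :: field_char_0 poly"
  assumes basis: "poly_basis n \<phi>"
  shows taylor_matrix_mult_V: "taylor_matrix n \<phi> * V_matrix n \<phi> = 1\<^sub>m (n + 1)"
    and V_mult_taylor_matrix: "V_matrix n \<phi> * taylor_matrix n \<phi> = 1\<^sub>m (n + 1)"
proof -
  have X: "X_vec n \<phi> k \<in> carrier_vec (n + 1)" "lin_comb n \<phi> (X_vec n \<phi> k) = monom 1 k"
    if "k \<le> n" for k
    using coeff_vec[OF basis, of "monom 1 k"] that
    by (simp_all add: X_vec_def degree_monom_eq)
  show "taylor_matrix n \<phi> * V_matrix n \<phi> = 1\<^sub>m (n + 1)"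
    unfolding V_matrix_def
    by (rule taylor_matrix_mult_mat_of_cols)
      (simp_all only: X lin_comb_smult smult_carrier_vec smult_monom mult_1_right)
  then show "V_matrix n \<phi> * taylor_matrix n \<phi> = 1\<^sub>m (n + 1)"
    by (rule mat_mult_left_right_inverse[OF taylor_matrix_carrier V_matrix_carrier])
qed

section \<open>Differentiation in Taylor coordinates\<close>

text \<open>The \<open>i\<close>-th derivative of p' at 0 is the derivative of p of order
  \<open>i + 1\<close> there; in coefficients, i! (i + 1) = (i + 1)!.\<close>

lemma taylor_matrix_pderiv:
  fixes \<phi> :: "nat \<Rightarrow> 'a :: field_char_0 poly"
  assumes basis: "poly_basis n \<phi>"
    and a: "a \<in> carrier_vec (n + 1)" and b: "b \<in> carrier_vec (n + 1)"
    and eq: "pderiv (lin_comb n \<phi> a) = lin_comb n \<phi> b"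
  shows "taylor_matrix n \<phi> *\<^sub>v b = J_matrix n *\<^sub>v (taylor_matrix n \<phi> *\<^sub>v a)"
proof (rule eq_vecI)
  let ?p = "lin_comb n \<phi> a"
  fix i assume "i < dim_vec (J_matrix n *\<^sub>v (taylor_matrix n \<phi> *\<^sub>v a))"
  then have i: "i < n + 1" by (simp add: J_matrix_def)
  have "(J_matrix n *\<^sub>v (taylor_matrix n \<phi> *\<^sub>v a)) $ i
      = (\<Sum>k = 0..<n + 1. (if k = i + 1 then 1 else 0) * (fact k * coeff ?p k))"
    unfolding taylor_matrix_mult_vec[OF a] using i
    by (auto simp: J_matrix_def scalar_prod_def intro!: sum.cong)
  also have "\<dots> = (\<Sum>k = 0..<n + 1. if k = i + 1 then fact k * coeff ?p k else 0)"
    by (rule sum.cong) auto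
  also have "\<dots> = (if i + 1 < n + 1 then fact (i + 1) * coeff ?p (i + 1) else 0)"
    by (subst sum.delta) auto
  \<comment> \<open>In the last row, \<open>i = n\<close>, the shift leaves 0; this agrees because
    the coefficient of index \<open>n + 1\<close> vanishes by the degree bound.\<close>
  also have "\<dots> = fact (i + 1) * coeff ?p (i + 1)"
    using degree_lin_comb_le[OF basis, of a] by (auto intro!: coeff_eq_0)
  also have "\<dots> = fact i * coeff (lin_comb n \<phi> b) i"
    by (simp add: eq[symmetric] coeff_pderiv algebra_simps)
  finally show "(taylor_matrix n \<phi> *\<^sub>v b) $ i = (J_matrix n *\<^sub>v (taylor_matrix n \<phi> *\<^sub>v a)) $ i"
    using i by (simp add: taylor_matrix_mult_vec[OF b])
qed (simp add: taylor_matrix_def J_matrix_def)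

lemma mult_unit_vec_eq_col:
  fixes A :: "'a :: semiring_1 mat"
  assumes A: "A \<in> carrier_mat m n" and j: "j < n"
  shows "A *\<^sub>v unit_vec n j = col A j"
proof (rule eq_vecI)
  fix i assume "i < dim_vec (col A j)"
  then have i: "i < m" using A by simp
  have "row A i \<in> carrier_vec n" using A i by simp
  then show "(A *\<^sub>v unit_vec n j) $ i = col A j $ i"
    using A i j by simp
qed simp

text \<open>The product meets the description in \<open>diff_matrix\<close> by conjugating the shift
  with the mutually inverse matrices; any other candidate agrees with it on unit vectors, hence
  column by column.\<close>

lemma diff_matrix_eq:
  fixes \<phi> :: "nat \<Rightarrow> 'a :: field_char_0 poly"
  assumes basis: "poly_basis n \<phi>"
  shows "diff_matrix n \<phi> = V_matrix n \<phi> * J_matrix n * taylor_matrix n \<phi>"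
proof -
  let ?V = "V_matrix n \<phi>" and ?J = "J_matrix n :: 'a mat" and ?C = "taylor_matrix n \<phi>"
  note VC = V_mult_taylor_matrix[OF basis]
  have VJ: "?V * ?J \<in> carrier_mat (n + 1) (n + 1)"
    by (rule mult_carrier_mat[OF V_matrix_carrier J_matrix_carrier])
  have represents: "b = ?V * ?J * ?C *\<^sub>v a"
    if a: "a \<in> carrier_vec (n + 1)" and b: "b \<in> carrier_vec (n + 1)"
      and eq: "pderiv (lin_comb n \<phi> a) = lin_comb n \<phi> b" for a b
  proof -
    have Ca: "?C *\<^sub>v a \<in> carrier_vec (n + 1)"
      by (rule mult_mat_vec_carrier[OF taylor_matrix_carrier a])
    have "b = ?V * ?C *\<^sub>v b" using b by (simp add: VC)
    also have "\<dots> = ?V *\<^sub>v (?C *\<^sub>v b)"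
      by (rule assoc_mult_mat_vec[OF V_matrix_carrier taylor_matrix_carrier b])
    also have "\<dots> = ?V *\<^sub>v (?J *\<^sub>v (?C *\<^sub>v a))"
      by (simp add: taylor_matrix_pderiv[OF basis a b eq])
    also have "\<dots> = ?V * ?J *\<^sub>v (?C *\<^sub>v a)"
      by (rule assoc_mult_mat_vec[OF V_matrix_carrier J_matrix_carrier Ca, symmetric])
    also have "\<dots> = ?V * ?J * ?C *\<^sub>v a"
      by (rule assoc_mult_mat_vec[OF VJ taylor_matrix_carrier a, symmetric])
    finally show ?thesis .
  qed
  show ?thesis
    unfolding diff_matrix_def
  proof (rule the_equality)
    show "?V * ?J * ?C \<in> carrier_mat (n + 1) (n + 1) \<and>
      (\<forall>a \<in> carrier_vec (n + 1). \<forall>b \<in> carrier_vec (n + 1).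
        pderiv (lin_comb n \<phi> a) = lin_comb n \<phi> b \<longrightarrow> b = ?V * ?J * ?C *\<^sub>v a)"
      using represents mult_carrier_mat[OF VJ taylor_matrix_carrier] by blast
  next
    fix D
    assume D: "D \<in> carrier_mat (n + 1) (n + 1) \<and>
      (\<forall>a \<in> carrier_vec (n + 1). \<forall>b \<in> carrier_vec (n + 1).
        pderiv (lin_comb n \<phi> a) = lin_comb n \<phi> b \<longrightarrow> b = D *\<^sub>v a)"
    have VJC: "?V * ?J * ?C \<in> carrier_mat (n + 1) (n + 1)"
      by (rule mult_carrier_mat[OF VJ taylor_matrix_carrier])
    show "D = ?V * ?J * ?C"
    proof (rule mat_col_eqI)
      fix j assume "j < dim_col (?V * ?J * ?C)"
      then have j: "j < n + 1" by (simp add: taylor_matrix_def)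
      let ?e = "unit_vec (n + 1) j :: 'a vec"
      \<comment> \<open>The condition on \<open>D\<close> says something at \<open>?e\<close> only
        if the derivative has coordinates \<open>b\<close>; the degree bound supplies them.\<close>
      have "degree (pderiv (lin_comb n \<phi> ?e)) \<le> n"
        using degree_lin_comb_le[OF basis, of ?e] by (simp add: degree_pderiv)
      then obtain b where b: "b \<in> carrier_vec (n + 1)"
          "pderiv (lin_comb n \<phi> ?e) = lin_comb n \<phi> b"
        using exists_lin_comb[OF basis] by metis
      have "D *\<^sub>v ?e = ?V * ?J * ?C *\<^sub>v ?e"
        using D b represents[OF unit_vec_carrier b] by auto
      then show "col D j = col (?V * ?J * ?C) j"
        unfolding mult_unit_vec_eq_col[OF VJC j] mult_unit_vec_eq_col[OF conjunct1[OF D] j] .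
    qed (simp_all only: carrier_matD[OF conjunct1[OF D]] carrier_matD[OF VJC])
  qed
qed

section \<open>The Jordan form and its uniqueness\<close>

lemma J_matrix_eq_jordan_matrix: "J_matrix n = jordan_matrix [(n + 1, 0)]"
  by (rule eq_matI) (auto simp: J_matrix_def jordan_matrix_def Let_def jordan_block_def)

text \<open>\<open>jordan_nf_unique\<close> identifies the sets of blocks; the multiplicity of the
  block then follows by comparing dimensions, since block sizes in \<open>jordan_nf\<close> are
  nonzero.\<close>

lemma jordan_nf_single_block_unique:
  fixes A :: "'a :: field mat"
  assumes "jordan_nf A [(m, c)]" and "jordan_nf A n_as"
  shows "n_as = [(m, c)]"
proof -
  have "set n_as = {(m, c)}"
    using jordan_nf_unique[OF assms] by simp
  then have n_as: "n_as = replicate (length n_as) (m, c)"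
    by (metis replicate_eqI singletonD)
  have sim: "similar_mat A (jordan_matrix [(m, c)])" "similar_mat A (jordan_matrix n_as)"
    and m: "m \<noteq> 0"
    using assms by (auto simp: jordan_nf_def)
  have "dim_row (jordan_matrix n_as) = dim_row (jordan_matrix [(m, c)])"
    using similar_matD[OF sim(1)] similar_matD[OF sim(2)] by fastforce
  then have "sum_list (map fst n_as) = m"
    by simp
  then have "length n_as * m = m"
    by (subst (asm) n_as) (simp add: sum_list_replicate)
  then have "length n_as = 1" using m by simp
  then show ?thesis using n_as by simp
qed

theorem mainTheorem2:
  fixes n :: nat and \<phi> :: "nat \<Rightarrow> 'a :: real_normed_field poly"
  assumes "poly_basis n \<phi>"
  shows "diff_matrix n \<phi> * V_matrix n \<phi> = V_matrix n \<phi> * J_matrix n \<and>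
         is_jordan_canonical_form (diff_matrix n \<phi>) (J_matrix n) \<and>
         (\<forall>M. is_jordan_canonical_form (diff_matrix n \<phi>) M \<longrightarrow> M = J_matrix n)"
proof -
  let ?V = "V_matrix n \<phi>" and ?J = "J_matrix n :: 'a mat" and ?C = "taylor_matrix n \<phi>"
  let ?D = "diff_matrix n \<phi>"
  note D = diff_matrix_eq[OF assms]
  have VJ: "?V * ?J \<in> carrier_mat (n + 1) (n + 1)"
    by (rule mult_carrier_mat[OF V_matrix_carrier J_matrix_carrier])
  then have D_carrier: "?D \<in> carrier_mat (n + 1) (n + 1)"
    unfolding D by (rule mult_carrier_mat[OF _ taylor_matrix_carrier])
  have "?D * ?V = ?V * ?J * (?C * ?V)"
    unfolding D by (rule assoc_mult_mat[OF VJ taylor_matrix_carrier V_matrix_carrier])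
  also have "\<dots> = ?V * ?J"
    unfolding taylor_matrix_mult_V[OF assms] by (rule right_mult_one_mat[OF VJ])
  finally have DV: "?D * ?V = ?V * ?J" .
  \<comment> \<open>\<open>?V\<close> and its inverse \<open>?C\<close> are the witnesses of
    similarity.\<close>
  have "{?D, ?J, ?V, ?C} \<subseteq> carrier_mat (n + 1) (n + 1)"
    using D_carrier V_matrix_carrier J_matrix_carrier taylor_matrix_carrier by blast
  then have "similar_mat ?D ?J"
    using V_mult_taylor_matrix[OF assms] taylor_matrix_mult_V[OF assms] D by (rule similar_matI)
  then have jnf: "jordan_nf ?D [(n + 1, 0)]"
    by (simp add: jordan_nf_def J_matrix_eq_jordan_matrix)
  \<comment> \<open>Jordan forms are in general unique up to the order of blocks; with a single
    block this becomes equality of matrices.\<close>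
  have "M = ?J" if M: "is_jordan_canonical_form ?D M" for M
  proof -
    obtain n_as where "jordan_nf ?D n_as" and "M = jordan_matrix n_as"
      using M unfolding is_jordan_canonical_form_def by blast
    then show ?thesis
      using jordan_nf_single_block_unique[OF jnf, of n_as] J_matrix_eq_jordan_matrix by metis
  qed
  moreover have "is_jordan_canonical_form ?D ?J"
    unfolding is_jordan_canonical_form_def using jnf J_matrix_eq_jordan_matrix by metis
  ultimately show ?thesis using DV by blast
qed

end
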